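(* Let $\mathscr{R}$ be a set of sound inference rules satisfying the following property: ( * ) for any rule in $\mathscr{R}$ that has more than one conclusion formula, any truth assignment that falsifies one of its conclusion formulas satisfies all its other conclusion formulas. Let $\mathscr{H}$ be a set of formulas (the hypotheses) and let $A$ be a formula (the goal). If there is a circular proof of $A$ from $\mathscr{H}$ through the rules in $\mathscr{R}$, then every truth assignment that satisfies every formula in $\mathscr{H}$ also satisfies $A$.
   Context: Formulas. A literal is a propositional variable $X$ or its negation $\overline{X}$. Formulas are in negation normal form: built from literals by disjunction and conjunction. Both $\vee$ and $\wedge$ are treated as associative, commutative and idempotent (i.e. as operations on finite sets of formulas); the empty disjunction $0$ is always false and the empty conjunction $1$ is always true. Truth assignments evaluate formulas as usual. Inference rules. An inference rule is given by a finite sequence of premise formulas $A_1,\dots,A_r$ and a finite sequence of conclusion formulas $B_1,\dots,B_s$; it is sound if every truth assignment satisfying all premises satisfies all conclusions. An instance of a rule is obtained by applying one substitution (of formulas for variables, a negated variable being replaced by the dual, i.e. De Morgan negation, of the substituted formula) to all its premises and conclusions. Circular proofs. A circular pre-proof $\Pi$ over a set of inference rules is a finite directed bipartite graph $G(\Pi)$ with two types of vertices, formula-vertices (set $J$) and inference-vertices (set $I$), every edge going between the two types. Each formula-vertex is labelled by a formula (different vertices may carry the same formula). Each inference-vertex is labelled by an instance of a rule whose premises are the formulas labelling its in-neighbours and whose conclusions are the formulas labelling its out-neighbours (one in-neighbour per premise, one out-neighbour per conclusion). Cycles are allowed. $N^-(u)$ and $N^+(u)$ denote the sets of in- and out-neighbours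 of $u$. A flow assignment is a map $F:I\to\mathbb{R}^+$ to the positive reals. The balance of $u\in J$ is $B(u)=\sum_{w\in N^-(u)}F(w)-\sum_{w\in N^+(u)}F(w)$. Formula-vertices with $B(u)<0$ are sources of $G(\Pi,F)$ and those with $B(u)>0$ are sinks. $F$ witnesses a proof of $A$ from $\mathscr{H}$ if every source is labelled by a formula in $\mathscr{H}$ and some sink is labelled by $A$. A circular proof of $A$ from $\mathscr{H}$ is a circular pre-proof for which there exists a flow assignment witnessing a proof of $A$ from $\mathscr{H}$. *)

theory Defs
  imports Complex_Main
begin

text \<open>Formulas in negation normal form. Disjunction and conjunction are operations on finite sets
  of formulas, so formulas are binary terms modulo the congruence generated by associativity,
  commutativity and idempotence, where the empty disjunction and the empty conjunction are the
  units. No other equivalence (absorption, distributivity, complements) is identified.\<close>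

datatype 'v pre_formula =
    PPos 'v
  | PNeg 'v
  | PBot
  | PTop
  | POr "'v pre_formula" "'v pre_formula"
  | PAnd "'v pre_formula" "'v pre_formula"

inductive aci :: "'v pre_formula \<Rightarrow> 'v pre_formula \<Rightarrow> bool" where
  aci_refl: "aci a a"
| aci_sym: "aci a b \<Longrightarrow> aci b a"
| aci_trans: "aci a b \<Longrightarrow> aci b c \<Longrightarrow> aci a c"
| aci_or_cong: "aci a a' \<Longrightarrow> aci b b' \<Longrightarrow> aci (POr a b) (POr a' b')"
| aci_and_cong: "aci a a' \<Longrightarrow> aci b b' \<Longrightarrow> aci (PAnd a b) (PAnd a' b')"
| aci_or_assoc: "aci (POr (POr a b) c) (POr a (POr b c))"
| aci_or_comm: "aci (POr a b) (POr b a)"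
| aci_or_idem: "aci (POr a a) a"
| aci_or_unit: "aci (POr PBot a) a"
| aci_and_assoc: "aci (PAnd (PAnd a b) c) (PAnd a (PAnd b c))"
| aci_and_comm: "aci (PAnd a b) (PAnd b a)"
| aci_and_idem: "aci (PAnd a a) a"
| aci_and_unit: "aci (PAnd PTop a) a"

primrec pre_sat :: "('v \<Rightarrow> bool) \<Rightarrow> 'v pre_formula \<Rightarrow> bool" where
  "pre_sat v (PPos x) \<longleftrightarrow> v x"
| "pre_sat v (PNeg x) \<longleftrightarrow> \<not> v x"
| "pre_sat v PBot \<longleftrightarrow> False"
| "pre_sat v PTop \<longleftrightarrow> True"
| "pre_sat v (POr a b) \<longleftrightarrow> pre_sat v a \<or> pre_sat v b"
| "pre_sat v (PAnd a b) \<longleftrightarrow> pre_sat v a \<and> pre_sat v b"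

primrec pre_dual :: "'v pre_formula \<Rightarrow> 'v pre_formula" where
  "pre_dual (PPos x) = PNeg x"
| "pre_dual (PNeg x) = PPos x"
| "pre_dual PBot = PTop"
| "pre_dual PTop = PBot"
| "pre_dual (POr a b) = PAnd (pre_dual a) (pre_dual b)"
| "pre_dual (PAnd a b) = POr (pre_dual a) (pre_dual b)"

primrec pre_subst :: "('v \<Rightarrow> 'v pre_formula) \<Rightarrow> 'v pre_formula \<Rightarrow> 'v pre_formula" where
  "pre_subst \<sigma> (PPos x) = \<sigma> x"
| "pre_subst \<sigma> (PNeg x) = pre_dual (\<sigma> x)"
| "pre_subst \<sigma> PBot = PBot"
| "pre_subst \<sigma> PTop = PTop"
| "pre_subst \<sigma> (POr a b) = POr (pre_subst \<sigma> a) (pre_subst \<sigma> b)"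
| "pre_subst \<sigma> (PAnd a b) = PAnd (pre_subst \<sigma> a) (pre_subst \<sigma> b)"

lemma aci_pre_sat: "aci a b \<Longrightarrow> pre_sat v a = pre_sat v b"
  by (induction rule: aci.induct) auto

lemma aci_pre_dual: "aci a b \<Longrightarrow> aci (pre_dual a) (pre_dual b)"
proof (induction rule: aci.induct)
  case (aci_sym a b)
  show ?case by (rule aci.aci_sym) fact
next
  case (aci_trans a b c)
  show ?case by (rule aci.aci_trans) fact+
qed (simp_all add: aci_refl aci_or_cong aci_and_cong aci_or_assoc aci_or_comm aci_or_idem
  aci_or_unit aci_and_assoc aci_and_comm aci_and_idem aci_and_unit)

lemma aci_pre_subst: "aci a b \<Longrightarrow> aci (pre_subst \<sigma> a) (pre_subst \<sigma> b)"
proof (induction rule: aci.induct)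
  case (aci_sym a b)
  show ?case by (rule aci.aci_sym) fact
next
  case (aci_trans a b c)
  show ?case by (rule aci.aci_trans) fact+
qed (simp_all add: aci_refl aci_or_cong aci_and_cong aci_or_assoc aci_or_comm aci_or_idem
  aci_or_unit aci_and_assoc aci_and_comm aci_and_idem aci_and_unit)

lemma aci_pre_subst_cong:
  assumes "\<And>x. aci (\<sigma> x) (\<tau> x)"
  shows "aci (pre_subst \<sigma> a) (pre_subst \<tau> a)"
  by (induction a) (simp_all add: assms aci_pre_dual aci_refl aci_or_cong aci_and_cong)

quotient_type 'v formula = "'v pre_formula" / aci
proof (rule equivpI)
  show "reflp aci" by (rule reflpI) (rule aci_refl)
  show "symp aci" by (rule sympI) (rule aci_sym)
  show "transp aci" by (rule transpI) (rule aci_trans)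
qed

lift_definition Pos :: "'v \<Rightarrow> 'v formula" is PPos .
lift_definition Neg :: "'v \<Rightarrow> 'v formula" is PNeg .
lift_definition Bot :: "'v formula" is PBot .
lift_definition Top :: "'v formula" is PTop .
lift_definition Or :: "'v formula \<Rightarrow> 'v formula \<Rightarrow> 'v formula" is POr by (rule aci_or_cong)
lift_definition And :: "'v formula \<Rightarrow> 'v formula \<Rightarrow> 'v formula" is PAnd by (rule aci_and_cong)

lift_definition sat :: "('v \<Rightarrow> bool) \<Rightarrow> 'v formula \<Rightarrow> bool" is pre_sat
  by (rule aci_pre_sat)

lift_definition dual :: "'v formula \<Rightarrow> 'v formula" is pre_dual
  by (rule aci_pre_dual)

lift_definition subst :: "('v \<Rightarrow> 'v formula) \<Rightarrow> 'v formula \<Rightarrow> 'v formula" is pre_subst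
  by (rule aci_trans, rule aci_pre_subst, assumption, rule aci_pre_subst_cong)

lemma Or_laws:
  "Or (Or a b) c = Or a (Or b c)" "Or a b = Or b a" "Or a a = a" "Or Bot a = a"
  subgoal by transfer (rule aci_or_assoc)
  subgoal by transfer (rule aci_or_comm)
  subgoal by transfer (rule aci_or_idem)
  subgoal by transfer (rule aci_or_unit)
  done

lemma And_laws:
  "And (And a b) c = And a (And b c)" "And a b = And b a" "And a a = a" "And Top a = a"
  subgoal by transfer (rule aci_and_assoc)
  subgoal by transfer (rule aci_and_comm)
  subgoal by transfer (rule aci_and_idem)
  subgoal by transfer (rule aci_and_unit)
  done

lemma sat_simps [simp]:
  "sat v (Pos x) \<longleftrightarrow> v x"
  "sat v (Neg x) \<longleftrightarrow> \<not> v x"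
  "\<not> sat v Bot"
  "sat v Top"
  "sat v (Or a b) \<longleftrightarrow> sat v a \<or> sat v b"
  "sat v (And a b) \<longleftrightarrow> sat v a \<and> sat v b"
  by (transfer, simp)+

lemma dual_simps [simp]:
  "dual (Pos x) = Neg x"
  "dual (Neg x) = Pos x"
  "dual Bot = Top"
  "dual Top = Bot"
  "dual (Or a b) = And (dual a) (dual b)"
  "dual (And a b) = Or (dual a) (dual b)"
  by (transfer, simp add: aci_refl)+

lemma subst_simps [simp]:
  "subst \<sigma> (Pos x) = \<sigma> x"
  "subst \<sigma> (Neg x) = dual (\<sigma> x)"
  "subst \<sigma> Bot = Bot"
  "subst \<sigma> Top = Top"
  "subst \<sigma> (Or a b) = Or (subst \<sigma> a) (subst \<sigma> b)"
  "subst \<sigma> (And a b) = And (subst \<sigma> a) (subst \<sigma> b)"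
  by (transfer, simp add: aci_refl aci_pre_dual)+

lemma formula_induct [case_names Pos Neg Bot Top Or And, induct type: formula]:
  assumes "\<And>x. P (Pos x)" "\<And>x. P (Neg x)" "P Bot" "P Top"
    and "\<And>a b. P a \<Longrightarrow> P b \<Longrightarrow> P (Or a b)" "\<And>a b. P a \<Longrightarrow> P b \<Longrightarrow> P (And a b)"
  shows "P a"
proof (induction a rule: formula.abs_induct)
  case (1 p)
  show ?case
    by (induction p)
      (use assms in \<open>simp_all add: Pos.abs_eq Neg.abs_eq Bot.abs_eq Top.abs_eq
        flip: Or.abs_eq And.abs_eq\<close>)
qed

datatype 'v rule = Rule (rule_premises: "'v formula list") (rule_conclusions: "'v formula list")

definition sound_rule :: "'v rule \<Rightarrow> bool" where
  "sound_rule r \<longleftrightarrow>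
    (\<forall>v. (\<forall>a\<in>set (rule_premises r). sat v a) \<longrightarrow> (\<forall>b\<in>set (rule_conclusions r). sat v b))"

text \<open>The other conclusions are those at other positions of the sequence: a formula that occurs
  twice among the conclusions counts as another conclusion of itself.\<close>

definition falsifies_at_most_one :: "'v rule \<Rightarrow> bool" where
  "falsifies_at_most_one r \<longleftrightarrow>
    (length (rule_conclusions r) > 1 \<longrightarrow>
      (\<forall>v. \<forall>i<length (rule_conclusions r). \<not> sat v (rule_conclusions r ! i) \<longrightarrow>
        (\<forall>j<length (rule_conclusions r). j \<noteq> i \<longrightarrow> sat v (rule_conclusions r ! j))))"

definition rule_instance :: "('v \<Rightarrow> 'v formula) \<Rightarrow> 'v rule \<Rightarrow> 'v rule" where
  "rule_instance \<sigma> r = Rule (map (subst \<sigma>) (rule_premises r)) (map (subst \<sigma>) (rule_conclusions r))"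

record ('n, 'v) proof_graph =
  formula_vertices :: "'n set"
  inference_vertices :: "'n set"
  edges :: "('n \<times> 'n) set"
  formula_label :: "'n \<Rightarrow> 'v formula"
  inference_label :: "'n \<Rightarrow> 'v rule"

definition in_nbrs :: "('n, 'v) proof_graph \<Rightarrow> 'n \<Rightarrow> 'n set" where
  "in_nbrs \<Pi> u = {w. (w, u) \<in> edges \<Pi>}"

definition out_nbrs :: "('n, 'v) proof_graph \<Rightarrow> 'n \<Rightarrow> 'n set" where
  "out_nbrs \<Pi> u = {w. (u, w) \<in> edges \<Pi>}"

definition enumerates_labels :: "('n, 'v) proof_graph \<Rightarrow> 'n set \<Rightarrow> 'v formula list \<Rightarrow> bool" where
  "enumerates_labels \<Pi> N as \<longleftrightarrow>
    (\<exists>f. bij_betw f {..<length as} N \<and> (\<forall>i<length as. formula_label \<Pi> (f i) = as ! i))"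

definition circular_pre_proof :: "'v rule set \<Rightarrow> ('n, 'v) proof_graph \<Rightarrow> bool" where
  "circular_pre_proof R \<Pi> \<longleftrightarrow>
    finite (formula_vertices \<Pi>) \<and>
    finite (inference_vertices \<Pi>) \<and>
    formula_vertices \<Pi> \<inter> inference_vertices \<Pi> = {} \<and>
    edges \<Pi> \<subseteq> formula_vertices \<Pi> \<times> inference_vertices \<Pi> \<union>
      inference_vertices \<Pi> \<times> formula_vertices \<Pi> \<and>
    (\<forall>w\<in>inference_vertices \<Pi>.
      (\<exists>r\<in>R. \<exists>\<sigma>. inference_label \<Pi> w = rule_instance \<sigma> r) \<and>
      enumerates_labels \<Pi> (in_nbrs \<Pi> w) (rule_premises (inference_label \<Pi> w)) \<and>
      enumerates_labels \<Pi> (out_nbrs \<Pi> w) (rule_conclusions (inference_label \<Pi> w)))"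

definition flow_assignment :: "('n, 'v) proof_graph \<Rightarrow> ('n \<Rightarrow> real) \<Rightarrow> bool" where
  "flow_assignment \<Pi> F \<longleftrightarrow> (\<forall>w\<in>inference_vertices \<Pi>. F w > 0)"

definition balance :: "('n, 'v) proof_graph \<Rightarrow> ('n \<Rightarrow> real) \<Rightarrow> 'n \<Rightarrow> real" where
  "balance \<Pi> F u = (\<Sum>w\<in>in_nbrs \<Pi> u. F w) - (\<Sum>w\<in>out_nbrs \<Pi> u. F w)"

definition sources :: "('n, 'v) proof_graph \<Rightarrow> ('n \<Rightarrow> real) \<Rightarrow> 'n set" where
  "sources \<Pi> F = {u \<in> formula_vertices \<Pi>. balance \<Pi> F u < 0}"

definition sinks :: "('n, 'v) proof_graph \<Rightarrow> ('n \<Rightarrow> real) \<Rightarrow> 'n set" where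
  "sinks \<Pi> F = {u \<in> formula_vertices \<Pi>. balance \<Pi> F u > 0}"

definition witnesses_proof ::
  "('n, 'v) proof_graph \<Rightarrow> ('n \<Rightarrow> real) \<Rightarrow> 'v formula set \<Rightarrow> 'v formula \<Rightarrow> bool" where
  "witnesses_proof \<Pi> F H A \<longleftrightarrow>
    (\<forall>u\<in>sources \<Pi> F. formula_label \<Pi> u \<in> H) \<and> (\<exists>u\<in>sinks \<Pi> F. formula_label \<Pi> u = A)"

definition circular_proof ::
  "'v rule set \<Rightarrow> 'v formula set \<Rightarrow> 'v formula \<Rightarrow> ('n, 'v) proof_graph \<Rightarrow> bool" where
  "circular_proof R H A \<Pi> \<longleftrightarrow>
    circular_pre_proof R \<Pi> \<and> (\<exists>F. flow_assignment \<Pi> F \<and> witnesses_proof \<Pi> F H A)"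

end

theory Submission
  imports Defs
begin

text \<open>Suppose an assignment satisfies the hypotheses but not the goal, and add up the balances of all
  falsified formula-vertices. No source is falsified, whereas some sink is, so the sum is positive.
  Grouped by inference-vertices, the same sum has a summand \<open>F w\<close> times (falsified conclusions of
  \<open>w\<close> minus falsified premises of \<open>w\<close>) for each \<open>w\<close>. By the property of the rules at most one conclusion is falsified, and
  by soundness some premise then is as well, so the sum is at most zero.\<close>

lemma sat_dual: "sat v (dual a) \<longleftrightarrow> \<not> sat v a"
  by (induction a) auto

text \<open>Negated variables go to duals, which \<open>sat_dual\<close> evaluates as negations, so
  \<open>v\<close> sees an instance as the pulled-back assignment sees the rule. Properties
  quantified over all assignments thus pass from rules to their instances.\<close>

lemma sat_subst: "sat v (subst \<sigma> a) \<longleftrightarrow> sat (\<lambda>x. sat v (\<sigma> x)) a"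
  by (induction a) (auto simp: sat_dual)

lemma sound_rule_instance:
  assumes "sound_rule r"
  shows "sound_rule (rule_instance \<sigma> r)"
  unfolding sound_rule_def rule_instance_def rule.sel
proof (intro allI)
  fix v
  show "(\<forall>a\<in>set (map (subst \<sigma>) (rule_premises r)). sat v a) \<longrightarrow>
    (\<forall>b\<in>set (map (subst \<sigma>) (rule_conclusions r)). sat v b)"
    using assms[unfolded sound_rule_def, THEN spec, of "\<lambda>x. sat v (\<sigma> x)"]
    by (simp add: sat_subst)
qed

lemma falsifies_at_most_one_instance:
  assumes "falsifies_at_most_one r"
  shows "falsifies_at_most_one (rule_instance \<sigma> r)"
  unfolding falsifies_at_most_one_def rule_instance_def rule.sel
proof (intro impI allI)
  let ?cs = "map (subst \<sigma>) (rule_conclusions r)"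
  fix v i j
  assume "length ?cs > 1" "i < length ?cs" "\<not> sat v (?cs ! i)" "j < length ?cs" "j \<noteq> i"
  then show "sat v (?cs ! j)"
    using assms unfolding falsifies_at_most_one_def
    by (metis length_map nth_map sat_subst)
qed

lemma enumerates_labels_set:
  assumes "enumerates_labels \<Pi> N as"
  shows "set as = formula_label \<Pi> ` N"
proof -
  obtain f where f: "bij_betw f {..<length as} N" "\<And>i. i < length as \<Longrightarrow> formula_label \<Pi> (f i) = as ! i"
    using assms unfolding enumerates_labels_def by blast
  have "formula_label \<Pi> ` N = (\<lambda>i. as ! i) ` {..<length as}"
    unfolding bij_betw_imp_surj_on[OF f(1), symmetric] image_image
    by (rule image_cong) (auto simp: f(2))
  then show ?thesis by (auto simp: in_set_conv_nth)
qed

lemma enumerates_labels_finite: "enumerates_labels \<Pi> N as \<Longrightarrow> finite N"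
  unfolding enumerates_labels_def by (auto dest: bij_betw_finite)

text \<open>Distinct vertices sit at distinct positions of the conclusion list even when they carry
  the same formula. This is why the property of the rules is stated for positions and not for
  formulas.\<close>

lemma falsified_conclusion_unique:
  assumes r: "falsifies_at_most_one r"
    and N: "enumerates_labels \<Pi> N (rule_conclusions r)"
    and u: "u \<in> N" "\<not> sat v (formula_label \<Pi> u)"
    and u': "u' \<in> N" "\<not> sat v (formula_label \<Pi> u')"
  shows "u = u'"
proof -
  let ?n = "length (rule_conclusions r)"
  obtain f where f: "bij_betw f {..<?n} N"
      "\<And>i. i < ?n \<Longrightarrow> formula_label \<Pi> (f i) = rule_conclusions r ! i"
    using N unfolding enumerates_labels_def by blast
  obtain i j where ij: "i < ?n" "u = f i" "j < ?n" "u' = f j"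
    using u(1) u'(1) bij_betw_imp_surj_on[OF f(1)] by auto
  then have "\<not> sat v (rule_conclusions r ! i)" "\<not> sat v (rule_conclusions r ! j)"
    using u(2) u'(2) f(2) by auto
  moreover have "?n > 1" if "i \<noteq> j"
    using that ij by linarith
  ultimately have "i = j"
    using r ij unfolding falsifies_at_most_one_def by metis
  then show ?thesis using ij by simp
qed

text \<open>The left side is 0 or 1 by uniqueness, so a single falsified premise vertex suffices;
  soundness, read contrapositively, provides one.\<close>

lemma card_falsified_conclusions_le:
  assumes sound: "sound_rule r" and star: "falsifies_at_most_one r"
    and P: "enumerates_labels \<Pi> P (rule_premises r)"
    and C: "enumerates_labels \<Pi> C (rule_conclusions r)"
  shows "card {u \<in> C. \<not> sat v (formula_label \<Pi> u)} \<le> card {u \<in> P. \<not> sat v (formula_label \<Pi> u)}"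
    (is "card ?C \<le> card ?P")
proof (cases "?C = {}")
  case True
  show ?thesis unfolding True by simp
next
  case False
  then obtain u where u: "u \<in> C" "\<not> sat v (formula_label \<Pi> u)" by blast
  then have "?C = {u}"
    using falsified_conclusion_unique[OF star C] by blast
  then have "card ?C = 1" by simp
  moreover have "?P \<noteq> {}"
    using sound[unfolded sound_rule_def, THEN spec, of v] u
      enumerates_labels_set[OF P] enumerates_labels_set[OF C] by auto
  \<comment> \<open>Finiteness matters here: \<open>card\<close> of an infinite set would be
    0.\<close>
  then have "card ?P > 0"
    using enumerates_labels_finite[OF P] by (simp add: card_gt_0_iff)
  ultimately show ?thesis by simp
qed

text \<open>Double counting of the edges between \<open>X\<close> and the inference-vertices: each
  edge entering \<open>X\<close> from \<open>w\<close> contributes \<open>F w\<close>, each edge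
  leaving \<open>X\<close> to \<open>w\<close> contributes \<open>- F w\<close>.\<close>

lemma sum_balance:
  assumes \<Pi>: "circular_pre_proof R \<Pi>" and X: "X \<subseteq> formula_vertices \<Pi>"
  shows "(\<Sum>u\<in>X. balance \<Pi> F u) =
    (\<Sum>w\<in>inference_vertices \<Pi>.
      F w * (real (card {u \<in> out_nbrs \<Pi> w. u \<in> X}) - real (card {u \<in> in_nbrs \<Pi> w. u \<in> X})))"
proof -
  let ?I = "inference_vertices \<Pi>" and ?E = "edges \<Pi>"
  have fin: "finite X" "finite ?I"
    using \<Pi> X unfolding circular_pre_proof_def by (auto intro: finite_subset)
  \<comment> \<open>Bipartiteness confines the neighbours of a formula-vertex to the finite set
    \<open>?I\<close>, which gives the restricted form needed to swap the sums.\<close>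
  have nbrs: "in_nbrs \<Pi> u = {w \<in> ?I. (w, u) \<in> ?E}" "out_nbrs \<Pi> u = {w \<in> ?I. (u, w) \<in> ?E}"
    if "u \<in> X" for u
    using \<Pi> X that unfolding circular_pre_proof_def in_nbrs_def out_nbrs_def by auto
  have ins: "(\<Sum>u\<in>X. \<Sum>w\<in>in_nbrs \<Pi> u. F w) =
      (\<Sum>w\<in>?I. F w * real (card {u \<in> out_nbrs \<Pi> w. u \<in> X}))"
  proof -
    have "(\<Sum>u\<in>X. \<Sum>w\<in>in_nbrs \<Pi> u. F w) = (\<Sum>u\<in>X. \<Sum>w | w \<in> ?I \<and> (w, u) \<in> ?E. F w)"
      by (simp add: nbrs)
    also have "\<dots> = (\<Sum>w\<in>?I. \<Sum>u | u \<in> X \<and> (w, u) \<in> ?E. F w)"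
      by (rule sum.swap_restrict[OF fin])
    \<comment> \<open>The inner summand \<open>F w\<close> does not depend on \<open>u\<close>, so
      the inner sum is \<open>F w\<close> times a cardinality.\<close>
    finally show ?thesis by (simp add: out_nbrs_def conj_commute mult.commute)
  qed
  have outs: "(\<Sum>u\<in>X. \<Sum>w\<in>out_nbrs \<Pi> u. F w) =
      (\<Sum>w\<in>?I. F w * real (card {u \<in> in_nbrs \<Pi> w. u \<in> X}))"
  proof -
    have "(\<Sum>u\<in>X. \<Sum>w\<in>out_nbrs \<Pi> u. F w) = (\<Sum>u\<in>X. \<Sum>w | w \<in> ?I \<and> (u, w) \<in> ?E. F w)"
      by (simp add: nbrs)
    also have "\<dots> = (\<Sum>w\<in>?I. \<Sum>u | u \<in> X \<and> (u, w) \<in> ?E. F w)"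
      by (rule sum.swap_restrict[OF fin])
    finally show ?thesis by (simp add: in_nbrs_def conj_commute mult.commute)
  qed
  show ?thesis
    by (simp add: balance_def sum_subtractf ins outs right_diff_distrib)
qed

lemma sum_balance_falsified_nonpos:
  assumes sound: "\<And>r. r \<in> R \<Longrightarrow> sound_rule r"
    and star: "\<And>r. r \<in> R \<Longrightarrow> falsifies_at_most_one r"
    and \<Pi>: "circular_pre_proof R \<Pi>" and F: "flow_assignment \<Pi> F"
  shows "(\<Sum>u | u \<in> formula_vertices \<Pi> \<and> \<not> sat v (formula_label \<Pi> u). balance \<Pi> F u) \<le> 0"
proof -
  let ?X = "{u \<in> formula_vertices \<Pi>. \<not> sat v (formula_label \<Pi> u)}"
  have "F w * (real (card {u \<in> out_nbrs \<Pi> w. u \<in> ?X}) - real (card {u \<in> in_nbrs \<Pi> w. u \<in> ?X})) \<le> 0"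
    if w: "w \<in> inference_vertices \<Pi>" for w
  proof -
    let ?r = "inference_label \<Pi> w"
    \<comment> \<open>By bipartiteness, membership of a neighbour of \<open>w\<close> in
      \<open>?X\<close> just means that its label is falsified.\<close>
    have "in_nbrs \<Pi> w \<subseteq> formula_vertices \<Pi>" "out_nbrs \<Pi> w \<subseteq> formula_vertices \<Pi>"
      using \<Pi> w unfolding circular_pre_proof_def in_nbrs_def out_nbrs_def by auto
    then have X: "{u \<in> out_nbrs \<Pi> w. u \<in> ?X} = {u \<in> out_nbrs \<Pi> w. \<not> sat v (formula_label \<Pi> u)}"
        "{u \<in> in_nbrs \<Pi> w. u \<in> ?X} = {u \<in> in_nbrs \<Pi> w. \<not> sat v (formula_label \<Pi> u)}"
      by auto
    have r: "\<exists>r\<in>R. \<exists>\<sigma>. ?r = rule_instance \<sigma> r"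
      and nbrs: "enumerates_labels \<Pi> (in_nbrs \<Pi> w) (rule_premises ?r)"
        "enumerates_labels \<Pi> (out_nbrs \<Pi> w) (rule_conclusions ?r)"
      using \<Pi> w unfolding circular_pre_proof_def by blast+
    have "sound_rule ?r" "falsifies_at_most_one ?r"
      using r sound star sound_rule_instance falsifies_at_most_one_instance by metis+
    then have "card {u \<in> out_nbrs \<Pi> w. u \<in> ?X} \<le> card {u \<in> in_nbrs \<Pi> w. u \<in> ?X}"
      unfolding X using nbrs by (rule card_falsified_conclusions_le)
    moreover have "F w > 0"
      using F w unfolding flow_assignment_def by blast
    ultimately show ?thesis by (intro mult_nonneg_nonpos) simp_all
  qed
  moreover have "?X \<subseteq> formula_vertices \<Pi>" by blast
  ultimately show ?thesis
    unfolding sum_balance[OF \<Pi> \<open>?X \<subseteq> formula_vertices \<Pi>\<close>] by (intro sum_nonpos)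
qed

theorem theorem2:
  fixes R :: "'v rule set" and H :: "'v formula set" and A :: "'v formula"
  assumes "\<And>r. r \<in> R \<Longrightarrow> sound_rule r"
    and "\<And>r. r \<in> R \<Longrightarrow> falsifies_at_most_one r"
    and "\<exists>\<Pi> :: ('n, 'v) proof_graph. circular_proof R H A \<Pi>"
  shows "\<forall>v. (\<forall>h\<in>H. sat v h) \<longrightarrow> sat v A"
proof (intro allI impI, rule ccontr)
  fix v assume H: "\<forall>h\<in>H. sat v h" and A: "\<not> sat v A"
  obtain \<Pi> :: "('n, 'v) proof_graph" and F where \<Pi>: "circular_pre_proof R \<Pi>"
      and F: "flow_assignment \<Pi> F" and wit: "witnesses_proof \<Pi> F H A"
    using assms(3) unfolding circular_proof_def by blast
  let ?X = "{u \<in> formula_vertices \<Pi>. \<not> sat v (formula_label \<Pi> u)}"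
  obtain s where s: "s \<in> ?X" "balance \<Pi> F s > 0"
    using wit A unfolding witnesses_proof_def sinks_def by blast
  \<comment> \<open>A falsified vertex of negative balance would be a source, hence labelled by a
    hypothesis, and \<open>v\<close> satisfies all of these.\<close>
  have "balance \<Pi> F u \<ge> 0" if "u \<in> ?X" for u
  proof (rule ccontr)
    assume "\<not> balance \<Pi> F u \<ge> 0"
    then have "u \<in> sources \<Pi> F"
      using that by (simp add: sources_def)
    then show False
      using wit H that unfolding witnesses_proof_def by blast
  qed
  moreover have "finite ?X"
    using \<Pi> unfolding circular_pre_proof_def by simp
  \<comment> \<open>All terms are nonnegative and the term of the sink \<open>s\<close> is
    positive.\<close>
  ultimately have "(\<Sum>u\<in>?X. balance \<Pi> F u) > 0"
    using s by (intro sum_pos2) auto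
  with sum_balance_falsified_nonpos[OF assms(1,2) \<Pi> F, of v] show False by simp
qed

end
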